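(* Let $0<q<p\le 1$, and let $\mathcal R(u,v)=\sum_{s,t=-\ell}^{\infty}r_{st}u^sv^t$ be a meromorphic function satisfying $\mathcal R(1,1)=0$, $\mathcal R(p^n,q^n)>0$ for all integers $n\ge1$, and convergent in a bidisc of $\mathbb C^2$. Define $$\|z\|_{\mathcal R(p,q)}:=\sup_{n\ge 1}\left(\frac{|z|}{\mathcal R(p^n,q^n)}\right)^{1/n},\qquad \mathbb D_{\mathcal R}(r):=\{z\in\mathbb C:\|z\|_{\mathcal R(p,q)}<r\}.$$ Let $R>0$, let $f$ be a function analytic in $\mathbb D_{\mathcal R}(R)$, and suppose that $f(0)\in\mathbb R$. Then for any $0<r<R$, $$|f(z)|\le\frac{2r}{R-r}\,\sup_{\|w\|_{\mathcal R(p,q)}<R}\Re f(w)+\frac{R+r}{R-r}\,|f(0)|,\qquad\forall z\in\mathbb D_{\mathcal R}(r).$$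
   Context: Here $r_{st}\in\mathbb C$ and $\ell$ is a nonnegative integer. *)

theory Defs
  imports "HOL-Complex_Analysis.Complex_Analysis"
begin

text \<open>
  The library treats holomorphic and meromorphic functions of one complex variable only; the
  following are the standard notions in two variables: complex differentiability on an open set,
  and local quotients of holomorphic functions whose denominator does not vanish identically on
  any nonempty open set.
\<close>

definition holomorphic2_on :: "(complex \<times> complex \<Rightarrow> complex) \<Rightarrow> (complex \<times> complex) set \<Rightarrow> bool" where
  "holomorphic2_on F U \<longleftrightarrow>
     open U \<and> (\<forall>x\<in>U. \<exists>a b. (F has_derivative (\<lambda>(h, k). a * h + b * k)) (at x))"

text \<open>The value of a meromorphic function at a zero of the chosen denominator is unconstrained.\<close>

definition meromorphic2_on :: "(complex \<times> complex \<Rightarrow> complex) \<Rightarrow> (complex \<times> complex) set \<Rightarrow> bool" where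
  "meromorphic2_on F \<Omega> \<longleftrightarrow>
     (\<forall>x\<in>\<Omega>. \<exists>U g h. x \<in> U \<and> holomorphic2_on g U \<and> holomorphic2_on h U \<and>
        (\<forall>V. open V \<and> V \<subseteq> U \<and> V \<noteq> {} \<longrightarrow> (\<exists>y\<in>V. h y \<noteq> 0)) \<and>
        (\<forall>y\<in>U. h y \<noteq> 0 \<longrightarrow> F y = g y / h y))"

definition regular2_at :: "(complex \<times> complex \<Rightarrow> complex) \<Rightarrow> complex \<times> complex \<Rightarrow> bool" where
  "regular2_at F x \<longleftrightarrow> (\<exists>U. x \<in> U \<and> holomorphic2_on F U)"

text \<open>
  Negative powers may occur, so the expansion is required only at points of the bidisc off the
  coordinate axes. For complex terms, convergence in the sense of \<open>has_sum\<close> is absolute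
  convergence, as is usual for double power series in a bidisc.
\<close>

definition has_laurent2_expansion ::
  "(complex \<times> complex \<Rightarrow> complex) \<Rightarrow> nat \<Rightarrow> (int \<Rightarrow> int \<Rightarrow> complex) \<Rightarrow> real \<Rightarrow> real \<Rightarrow> bool" where
  "has_laurent2_expansion F l c \<rho>\<^sub>1 \<rho>\<^sub>2 \<longleftrightarrow>
     (\<forall>u v. u \<noteq> 0 \<and> cmod u < \<rho>\<^sub>1 \<and> v \<noteq> 0 \<and> cmod v < \<rho>\<^sub>2 \<longrightarrow>
        ((\<lambda>(s, t). c s t * u powi s * v powi t) has_sum F (u, v)) ({- int l..} \<times> {- int l..}))"

text \<open>
  The point \<open>(p ^ n, q ^ n)\<close>; the values of \<open>F\<close> there are used only when they are positive reals,
  in which case \<open>Re\<close> does not change them. The supremum may be infinite.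
\<close>

definition pq_point :: "real \<Rightarrow> real \<Rightarrow> nat \<Rightarrow> complex \<times> complex" where
  "pq_point p q n = (complex_of_real (p ^ n), complex_of_real (q ^ n))"

definition deformed_norm :: "(complex \<times> complex \<Rightarrow> complex) \<Rightarrow> real \<Rightarrow> real \<Rightarrow> complex \<Rightarrow> ereal" where
  "deformed_norm F p q z = (SUP n\<in>{1..}. ereal (root n (cmod z / Re (F (pq_point p q n)))))"

definition deformed_disc :: "(complex \<times> complex \<Rightarrow> complex) \<Rightarrow> real \<Rightarrow> real \<Rightarrow> real \<Rightarrow> complex set" where
  "deformed_disc F p q r = {z. deformed_norm F p q z < ereal r}"

end

theory Submission imports Defs begin

text \<open>
  The estimate is the Borel--Caratheodory theorem in disguise. The function
  \<open>\<parallel>\<cdot>\<parallel>\<close> is not a norm (the \<open>n\<close>-th roots destroy homogeneity), but it depends only on \<open>cmod z\<close>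
  and satisfies \<open>\<parallel>a z\<parallel> \<le> a \<parallel>z\<parallel>\<close> for \<open>a \<ge> 1\<close>, since \<open>root n a \<le> a\<close> there
  (\<open>deformed_norm_le_scaled\<close>). Hence if \<open>z \<noteq> 0\<close> lies in the deformed disc of radius \<open>r\<close>, then the
  ordinary disc of radius \<open>(R / r) cmod z\<close> about \<open>0\<close> lies in the deformed disc of radius \<open>R\<close>
  (\<open>ball_subset_deformed_disc\<close>). In that ordinary disc \<open>z\<close> sits at relative radius exactly
  \<open>r / R\<close>, so the classical inequality (\<open>Borel_Caratheodory\<close>) gives the constants
  \<open>2 r / (R - r)\<close> and \<open>(R + r) / (R - r) = 1 + 2 r / (R - r)\<close>.

  At \<open>z = 0\<close>, the only point if the deformed discs degenerate to \<open>{0}\<close>, the inequality follows from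
  \<open>Re (f 0) \<le> sup Re f\<close>.
\<close>

section \<open>The Borel--Caratheodory inequality\<close>

text \<open>
  The map \<open>\<zeta> \<mapsto> \<zeta> / (2 M - \<zeta>)\<close> sends the half-plane \<open>Re \<zeta> < M\<close> into the unit disc and fixes \<open>0\<close>, so
  the Schwarz lemma applies to its composition with \<open>f - f a\<close>, rescaled to the unit disc.
\<close>

lemma Borel_Caratheodory_strict:
  fixes f :: "complex \<Rightarrow> complex"
  assumes hol: "f holomorphic_on ball a \<rho>"
    and less: "\<And>w. w \<in> ball a \<rho> \<Longrightarrow> Re (f w) < A"
    and z: "z \<in> ball a \<rho>"
  shows "(\<rho> - dist a z) * cmod (f z - f a) \<le> 2 * dist a z * (A - Re (f a))"
proof -
  have \<rho>: "\<rho> > 0"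
    using z by (metis ball_eq_empty empty_iff not_less)
  define M where "M = A - Re (f a)"
  have M: "M > 0"
    using less[of a] \<rho> by (simp add: M_def)
  define g where "g = (\<lambda>x. f (a + of_real \<rho> * x) - f a)"
  define \<phi> where "\<phi> = (\<lambda>x. g x / (of_real (2 * M) - g x))"
  have in_ball: "a + of_real \<rho> * x \<in> ball a \<rho>" if "x \<in> ball 0 1" for x
    using that \<rho> by (simp add: dist_norm norm_mult)
  have g_Re: "Re (g x) < M" if "x \<in> ball 0 1" for x
    using less[OF in_ball[OF that]] by (simp add: g_def M_def)
  have nz: "of_real (2 * M) - g x \<noteq> 0" if "x \<in> ball 0 1" for x
  proof
    assume "of_real (2 * M) - g x = 0"
    then have "Re (g x) = 2 * M"
      by (metis Re_complex_of_real eq_iff_diff_eq_0)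
    then show False
      using g_Re[OF that] M by simp
  qed
  have g_hol: "g holomorphic_on ball 0 1"
    unfolding g_def
    by (intro holomorphic_intros holomorphic_on_compose_gen[OF _ hol, unfolded o_def])
      (use in_ball in auto)
  have \<phi>_hol: "\<phi> holomorphic_on ball 0 1"
    unfolding \<phi>_def using g_hol nz by (auto intro!: holomorphic_intros)
  have \<phi>_0: "\<phi> 0 = 0"
    by (simp add: \<phi>_def g_def)
  have \<phi>_less: "cmod (\<phi> x) < 1" if "cmod x < 1" for x
  proof -
    have x: "x \<in> ball 0 1"
      using that by simp
    have "(2 * M - Re (g x))\<^sup>2 - (Re (g x))\<^sup>2 = 4 * M * (M - Re (g x))"
      by (simp add: power2_eq_square algebra_simps)
    moreover have "4 * M * (M - Re (g x)) > 0"
      using M g_Re[OF x] by simp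
    ultimately have "(cmod (g x))\<^sup>2 < (cmod (of_real (2 * M) - g x))\<^sup>2"
      by (simp add: cmod_power2)
    then have "cmod (g x) < cmod (of_real (2 * M) - g x)"
      using norm_ge_zero power2_less_imp_less by blast
    then show ?thesis
      using nz[OF x] by (simp add: \<phi>_def norm_divide)
  qed
  define x where "x = (z - a) / of_real \<rho>"
  have x: "cmod x = dist a z / \<rho>"
    using \<rho> by (simp add: x_def norm_divide dist_norm norm_minus_commute)
  then have x_less: "cmod x < 1"
    using z \<rho> by simp
  have gx: "g x = f z - f a"
    using \<rho> by (simp add: g_def x_def)
  have "cmod (\<phi> x) \<le> cmod x"
    by (rule Schwarz_Lemma(1)[OF \<phi>_hol \<phi>_0 \<phi>_less x_less])
  then have "cmod (g x) \<le> cmod x * cmod (of_real (2 * M) - g x)"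
    using nz[of x] x_less by (simp add: \<phi>_def norm_divide pos_divide_le_eq)
  also have "\<dots> \<le> cmod x * (2 * M + cmod (g x))"
    using norm_triangle_ineq4[of "of_real (2 * M)" "g x"] M
    by (intro mult_left_mono) (simp_all add: norm_mult)
  finally have "\<rho> * cmod (g x) \<le> \<rho> * (cmod x * (2 * M + cmod (g x)))"
    using \<rho> by (intro mult_left_mono) auto
  also have "\<dots> = dist a z * (2 * M + cmod (g x))"
    using \<rho> by (simp add: x)
  finally show ?thesis
    by (simp add: gx M_def algebra_simps)
qed

lemma Borel_Caratheodory:
  fixes f :: "complex \<Rightarrow> complex"
  assumes hol: "f holomorphic_on ball a \<rho>"
    and le: "\<And>w. w \<in> ball a \<rho> \<Longrightarrow> Re (f w) \<le> A"
    and z: "z \<in> ball a \<rho>"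
  shows "cmod (f z - f a) \<le> 2 * dist a z / (\<rho> - dist a z) * (A - Re (f a))"
proof -
  have dist: "dist a z < \<rho>"
    using z by simp
  \<comment> \<open>A constant \<open>f\<close> may attain the bound \<open>A\<close>, hence the passage to the limit from \<open>B > A\<close>.\<close>
  have bound: "(\<rho> - dist a z) * cmod (f z - f a) \<le> 2 * dist a z * (B - Re (f a))" if "B > A" for B
    by (rule Borel_Caratheodory_strict[OF hol _ z]) (use le that in force)
  have "((\<lambda>B. 2 * dist a z * (B - Re (f a))) \<longlongrightarrow> 2 * dist a z * (A - Re (f a))) (at_right A)"
    by (intro tendsto_intros)
  then have "(\<rho> - dist a z) * cmod (f z - f a) \<le> 2 * dist a z * (A - Re (f a))"
    by (rule tendsto_lowerbound)
      (use bound in \<open>auto intro: eventually_mono[OF eventually_at_right_less]\<close>)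
  then show ?thesis
    using dist by (simp add: field_simps)
qed

section \<open>Discs inside the deformed disc\<close>

text \<open>
  Scaling by \<open>a\<close> multiplies the \<open>n\<close>-th term of the supremum by \<open>root n a\<close>, which is largest at
  \<open>n = 1\<close> because \<open>a \<ge> 1\<close>.
\<close>

lemma deformed_norm_le_scaled:
  assumes pos: "\<And>n. n \<ge> 1 \<Longrightarrow> Re (F (pq_point p q n)) > 0"
    and a: "1 \<le> a" and le: "cmod w \<le> a * cmod z"
  shows "deformed_norm F p q w \<le> ereal a * deformed_norm F p q z"
  unfolding deformed_norm_def
proof (rule SUP_least)
  fix n :: nat assume n: "n \<in> {1..}"
  let ?x = "Re (F (pq_point p q n))"
  have root_a: "root n a \<le> a"
  proof -
    have "a \<le> a ^ n"
      using a n by (simp add: self_le_power)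
    then have "root n a \<le> root n (a ^ n)"
      using n by simp
    also have "\<dots> = a"
      using a n by (simp add: real_root_power_cancel)
    finally show ?thesis .
  qed
  have "root n (cmod w / ?x) \<le> root n (a * (cmod z / ?x))"
    using n le pos[of n] by (simp add: divide_right_mono)
  also have "\<dots> = root n a * root n (cmod z / ?x)"
    by (rule real_root_mult)
  also have "\<dots> \<le> a * root n (cmod z / ?x)"
    using root_a n pos[of n] by (intro mult_right_mono) auto
  finally have "ereal (root n (cmod w / ?x)) \<le> ereal a * ereal (root n (cmod z / ?x))"
    by simp
  also have "\<dots> \<le> ereal a * (SUP n\<in>{1..}. ereal (root n (cmod z / Re (F (pq_point p q n)))))"
    using a n by (intro ereal_mult_left_mono SUP_upper) auto
  finally show "ereal (root n (cmod w / ?x))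
    \<le> ereal a * (SUP n\<in>{1..}. ereal (root n (cmod z / Re (F (pq_point p q n)))))" .
qed

lemma zero_in_deformed_disc: "R > 0 \<Longrightarrow> 0 \<in> deformed_disc F p q R"
  by (simp add: deformed_disc_def deformed_norm_def)

text \<open>
  The radius exceeds \<open>cmod z\<close> by exactly the factor \<open>R / r\<close>; this is the ratio that fixes the
  constants of the final estimate.
\<close>

lemma ball_subset_deformed_disc:
  assumes pos: "\<And>n. n \<ge> 1 \<Longrightarrow> Re (F (pq_point p q n)) > 0"
    and r: "0 < r" "r \<le> R" and z: "z \<in> deformed_disc F p q r"
  shows "ball 0 (R / r * cmod z) \<subseteq> deformed_disc F p q R"
proof
  fix w :: complex assume "w \<in> ball 0 (R / r * cmod z)"
  then have "deformed_norm F p q w \<le> ereal (R / r) * deformed_norm F p q z"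
    using r pos by (intro deformed_norm_le_scaled) auto
  also have "\<dots> < ereal (R / r) * ereal r"
    using z r by (intro ereal_mult_strict_left_mono) (auto simp: deformed_disc_def)
  also have "\<dots> = ereal R"
    using r by simp
  finally show "w \<in> deformed_disc F p q R"
    by (simp add: deformed_disc_def)
qed

section \<open>The Borel--Caratheodory inequality on deformed discs\<close>

theorem lemma2:
  fixes p q :: real
    and \<R> :: "complex \<times> complex \<Rightarrow> complex"
    and c :: "int \<Rightarrow> int \<Rightarrow> complex" and l :: nat
    and \<rho>\<^sub>1 \<rho>\<^sub>2 :: real and \<Omega> :: "(complex \<times> complex) set"
    and R r :: real and f :: "complex \<Rightarrow> complex"
  assumes "0 < q" and "q < p" and "p \<le> 1"
    and "open \<Omega>" and "connected \<Omega>" and "meromorphic2_on \<R> \<Omega>"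
    and "\<rho>\<^sub>1 > 0" and "\<rho>\<^sub>2 > 0" and "ball 0 \<rho>\<^sub>1 \<times> ball 0 \<rho>\<^sub>2 \<subseteq> \<Omega>"
    and "has_laurent2_expansion \<R> l c \<rho>\<^sub>1 \<rho>\<^sub>2"
    and "(1, 1) \<in> \<Omega>" and "regular2_at \<R> (1, 1)" and "\<R> (1, 1) = 0"
    and "\<And>n. n \<ge> 1 \<Longrightarrow> pq_point p q n \<in> \<Omega> \<and> regular2_at \<R> (pq_point p q n)"
    and "\<And>n. n \<ge> 1 \<Longrightarrow> \<R> (pq_point p q n) \<in> \<real> \<and> Re (\<R> (pq_point p q n)) > 0"
    and "R > 0" and "f analytic_on deformed_disc \<R> p q R" and "f 0 \<in> \<real>"
    and "0 < r" and "r < R"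
  shows "\<forall>z \<in> deformed_disc \<R> p q r.
           ereal (cmod (f z)) \<le>
             ereal (2 * r / (R - r)) * (SUP w \<in> deformed_disc \<R> p q R. ereal (Re (f w)))
             + ereal ((R + r) / (R - r) * cmod (f 0))"
proof
  fix z assume z: "z \<in> deformed_disc \<R> p q r"
  let ?S = "SUP w \<in> deformed_disc \<R> p q R. ereal (Re (f w))"
  define K where "K = 2 * r / (R - r)"
  have K: "K > 0" and K1: "(R + r) / (R - r) = 1 + K"
    using \<open>0 < r\<close> \<open>r < R\<close> by (auto simp: K_def field_simps)
  have upper: "ereal (Re (f w)) \<le> ?S" if "w \<in> deformed_disc \<R> p q R" for w
    using that by (rule SUP_upper)
  have f0_le: "ereal (Re (f 0)) \<le> ?S"
    using \<open>R > 0\<close> by (intro upper zero_in_deformed_disc)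
  show "ereal (cmod (f z)) \<le> ereal (2 * r / (R - r)) * ?S
      + ereal ((R + r) / (R - r) * cmod (f 0))"
  proof (cases ?S)
    case (real A)
    have Re_le: "Re (f w) \<le> A" if "w \<in> deformed_disc \<R> p q R" for w
      using upper[OF that] real by simp
    have A: "A - Re (f 0) \<ge> 0"
      using f0_le real by simp
    have diff: "cmod (f z - f 0) \<le> K * (A - Re (f 0))"
    proof (cases "z = 0")
      case True
      then show ?thesis
        using K A by simp
    next
      case False
      let ?\<rho> = "R / r * cmod z"
      have sub: "ball 0 ?\<rho> \<subseteq> deformed_disc \<R> p q R"
        using ball_subset_deformed_disc[of \<R> p q r R z] assms(15) z \<open>0 < r\<close> \<open>r < R\<close> by auto
      have hol: "f holomorphic_on ball 0 ?\<rho>"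
        using \<open>f analytic_on deformed_disc \<R> p q R\<close> sub
        by (meson analytic_imp_holomorphic holomorphic_on_subset)
      have zin: "z \<in> ball 0 ?\<rho>"
        using False \<open>0 < r\<close> \<open>r < R\<close> by (simp add: field_simps)
      have "cmod (f z - f 0) \<le> 2 * dist 0 z / (?\<rho> - dist 0 z) * (A - Re (f 0))"
        by (rule Borel_Caratheodory[OF hol _ zin]) (use sub Re_le in blast)
      also have "2 * dist 0 z / (?\<rho> - dist 0 z) = K"
        using False \<open>0 < r\<close> \<open>r < R\<close> by (simp add: K_def divide_simps) (simp add: algebra_simps)
      finally show ?thesis .
    qed
    have "cmod (f z) \<le> cmod (f z - f 0) + cmod (f 0)"
      using norm_triangle_sub[of "f z" "f 0"] by simp
    also have "\<dots> \<le> K * (A + cmod (f 0)) + cmod (f 0)"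
    proof -
      have "- Re (f 0) \<le> cmod (f 0)"
        using abs_Re_le_cmod[of "f 0"] by linarith
      then have "K * (A - Re (f 0)) \<le> K * (A + cmod (f 0))"
        using K by (intro mult_left_mono) auto
      then show ?thesis
        using diff by simp
    qed
    also have "\<dots> = K * A + (1 + K) * cmod (f 0)"
      by (simp add: algebra_simps)
    finally show ?thesis
      by (simp only: real K1 flip: K_def) simp
  next
    case PInf
    then show ?thesis
      using K by (simp flip: K_def)
  next
    case MInf
    then show ?thesis
      using f0_le by simp
  qed
qed

end
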